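(* Let $n\geq 3$ be odd and let $K_{1,n}$ be the star with center $r$, leaves $v_0,\dots,v_{n-1}$, and edges $i=rv_i$ for $0\leq i<n$. Let $S=\{\{v_i,v_{(i+1)\bmod n}\}:0\leq i<n\}$. Then the inequality $\sum_{e\in E(K_{1,n})}x_e\geq\lceil n/2\rceil$ defines a shared facet of $\mathrm{MultC}(K_{1,n},S)$.
   Context: Given a graph $G=(V,E)$ and $S\subseteq\binom{V}{2}$, an ($S$-)multicut is a set $\delta\subseteq E$ such that for every $\{s,t\}\in S$ the nodes $s$ and $t$ lie in different components of $G-\delta$. For $F\subseteq E$, $x^F\in\mathbb{R}^E$ is its incidence vector. The multicut polytope is $\mathrm{MultC}^{\square}(G,S)=\mathrm{conv}\{x^\delta:\delta\text{ an } S\text{-multicut}\}$ and the multicut dominant is $\mathrm{MultC}(G,S)=\mathrm{MultC}^{\square}(G,S)+\mathbb{R}^E_{\geq 0}$. A facet-defining inequality of $\mathrm{MultC}(G,S)$ defines a shared facet if it is also facet-defining for $\mathrm{MultC}^{\square}(G,S)$. *)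

theory Defs
  imports "HOL-Analysis.Analysis"
begin

text \<open>
  Finite simple graphs are given by a vertex set \<open>V\<close> and a set \<open>E\<close> of two-element subsets of \<open>V\<close>;
  the vertex type is finite but may be larger than \<open>V\<close>. The space \<open>\<real>\<^sup>E\<close> is the subspace
  \<open>edge_space E\<close> of those vectors of \<^typ>\<open>real ^ ('v::finite set)\<close> that vanish outside \<open>E\<close>. Faces,
  affine dimension and facets do not depend on the surrounding space.
\<close>

definition pairs :: "'v set \<Rightarrow> 'v set set" where
  "pairs V = {e. e \<subseteq> V \<and> card e = 2}"

definition edge_space :: "'v set set \<Rightarrow> (real ^ ('v::finite set)) set" where
  "edge_space E = {x. \<forall>e. e \<notin> E \<longrightarrow> x $ e = 0}"

definition nonneg_orthant :: "'v set set \<Rightarrow> (real ^ ('v::finite set)) set" where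
  "nonneg_orthant E = {x \<in> edge_space E. \<forall>e\<in>E. 0 \<le> x $ e}"

definition incidence_vector :: "'v set set \<Rightarrow> real ^ ('v::finite set)" where
  "incidence_vector F = (\<chi> e. if e \<in> F then 1 else 0)"

definition component :: "'v set \<Rightarrow> 'v set set \<Rightarrow> 'v \<Rightarrow> 'v set" where
  "component V E u = {w \<in> V. (u, w) \<in> {(a, b). {a, b} \<in> E}\<^sup>*}"

definition multicut :: "'v set \<Rightarrow> 'v set set \<Rightarrow> 'v set set \<Rightarrow> 'v set set \<Rightarrow> bool" where
  "multicut V E S \<delta> \<longleftrightarrow>
     \<delta> \<subseteq> E \<and> (\<forall>s t. {s, t} \<in> S \<longrightarrow> component V (E - \<delta>) s \<noteq> component V (E - \<delta>) t)"

definition multicut_polytope ::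
  "'v set \<Rightarrow> 'v set set \<Rightarrow> 'v set set \<Rightarrow> (real ^ ('v::finite set)) set" where
  "multicut_polytope V E S = convex hull {incidence_vector \<delta> | \<delta>. multicut V E S \<delta>}"

definition multicut_dominant ::
  "'v set \<Rightarrow> 'v set set \<Rightarrow> 'v set set \<Rightarrow> (real ^ ('v::finite set)) set" where
  "multicut_dominant V E S = multicut_polytope V E S + nonneg_orthant E"

text \<open>\<open>facet_defining f b P\<close>: the linear inequality \<open>f x \<ge> b\<close> is valid for \<open>P\<close> and defines a facet.\<close>

definition facet_defining :: "('a::euclidean_space \<Rightarrow> real) \<Rightarrow> real \<Rightarrow> 'a set \<Rightarrow> bool" where
  "facet_defining f b P \<longleftrightarrow>
     linear f \<and> (\<forall>x\<in>P. f x \<ge> b) \<and> {x \<in> P. f x = b} facet_of P"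

definition defines_shared_facet ::
  "'v set \<Rightarrow> 'v set set \<Rightarrow> 'v set set \<Rightarrow> (real ^ ('v::finite set) \<Rightarrow> real) \<Rightarrow> real \<Rightarrow> bool" where
  "defines_shared_facet V E S f b \<longleftrightarrow>
     facet_defining f b (multicut_dominant V E S) \<and>
     facet_defining f b (multicut_polytope V E S)"

definition star_vertices :: "nat \<Rightarrow> 'v \<Rightarrow> (nat \<Rightarrow> 'v) \<Rightarrow> 'v set" where
  "star_vertices n r v = insert r (v ` {..<n})"

definition star_edges :: "nat \<Rightarrow> 'v \<Rightarrow> (nat \<Rightarrow> 'v) \<Rightarrow> 'v set set" where
  "star_edges n r v = {{r, v i} | i. i < n}"

definition cyclic_terminal_pairs :: "nat \<Rightarrow> (nat \<Rightarrow> 'v) \<Rightarrow> 'v set set" where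
  "cyclic_terminal_pairs n v = {{v i, v ((i + 1) mod n)} | i. i < n}"

lemma star_edges_subset_pairs:
  assumes "r \<notin> v ` {..<n}"
  shows "star_edges n r v \<subseteq> pairs (star_vertices n r v)"
  using assms by (auto simp: star_edges_def pairs_def star_vertices_def card_2_iff)

lemma cyclic_terminal_pairs_subset_pairs:
  assumes "n \<ge> 3" and "inj_on v {..<n}"
  shows "cyclic_terminal_pairs n v \<subseteq> pairs (star_vertices n r v)"
proof -
  have "v i \<noteq> v ((i + 1) mod n)" if "i < n" for i
  proof
    assume "v i = v ((i + 1) mod n)"
    then have "i = (i + 1) mod n"
      using assms that by (auto dest: inj_onD)
    then show False
      using assms(1) that by (cases "i + 1 = n") auto
  qed
  then show ?thesis
    using assms(1) by (auto simp: cyclic_terminal_pairs_def pairs_def star_vertices_def)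
qed

end

theory Submission
  imports Defs
begin

text \<open>
  A set of edges of the star is a multicut iff it contains one of any two cyclically consecutive
  edges. Adding up the \<open>n\<close> inequalities \<open>x\<^sub>i + x\<^sub>i\<^sub>+\<^sub>1 \<ge> 1\<close> shows that a multicut has at least \<open>n / 2\<close>
  edges. For \<open>n = 2 * m + 1\<close>, the sets \<open>{k, k + 2, \<dots>, k + 2 * m}\<close> (modulo \<open>n\<close>) are multicuts of
  size \<open>m + 1\<close>. Passing from \<open>k\<close> to \<open>k + 2\<close> exchanges the edge \<open>k\<close> for the edge
  \<open>k + 2 * m + 2 = k + 1\<close>, so the differences of all unit vectors, and with them the whole of
  \<open>\<real>\<^sup>E\<close>, are spanned by the points of the face.
\<close>

subsection \<open>Facets\<close>

text \<open>Adjoining the origin raises the affine dimension of the face by at most one and makes it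
  equal to the dimension of its linear span, which contains \<open>P\<close>. The point
  \<open>y\<close> makes the face proper, so its dimension is exactly one below that of
  \<open>P\<close>, whatever the latter is.\<close>

lemma facet_definingI:
  fixes f :: "'a::euclidean_space \<Rightarrow> real"
  assumes "linear f" and "convex P" and valid: "\<And>x. x \<in> P \<Longrightarrow> f x \<ge> b"
    and "z \<in> P" "f z = b" and "y \<in> P" "f y \<noteq> b"
    and spanning: "P \<subseteq> span {x \<in> P. f x = b}"
  shows "facet_defining f b P"
proof -
  define F where "F = {x \<in> P. f x = b}"
  \<comment> \<open>By Riesz representation, \<open>adjoint f 1\<close> is the normal vector of the
    hyperplane \<open>f x = b\<close>, which turns the face into a supporting-hyperplane
    section.\<close>
  have f_inner: "f x = adjoint f 1 \<bullet> x" for x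
    using adjoint_works[OF \<open>linear f\<close>, of x 1] by (simp add: inner_commute)
  have "F = P \<inter> {x. adjoint f 1 \<bullet> x = b}"
    by (auto simp: F_def f_inner)
  then have face: "F face_of P"
    using face_of_Int_supporting_hyperplane_ge[OF \<open>convex P\<close>, where a = "adjoint f 1" and b = b] valid
    by (simp add: f_inner)
  have "F \<noteq> P"
    using \<open>y \<in> P\<close> \<open>f y \<noteq> b\<close> by (auto simp: F_def)
  then have "aff_dim F < aff_dim P"
    using face_of_aff_dim_lt[OF \<open>convex P\<close> face] by simp
  moreover have "aff_dim P \<le> aff_dim F + 1"
  proof -
    have "aff_dim P \<le> aff_dim (span F)"
      using spanning by (simp add: F_def aff_dim_subset)
    also have "\<dots> = int (dim (insert 0 F))"
      by (metis aff_dim_subspace dim_span span_insert_0 subspace_span)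
    also have "\<dots> = aff_dim (insert 0 F)"
      by (rule aff_dim_zero[symmetric]) (simp add: hull_inc)
    also have "\<dots> \<le> aff_dim F + 1"
      by (simp add: aff_dim_insert)
    finally show ?thesis .
  qed
  moreover have "F \<noteq> {}"
    using \<open>z \<in> P\<close> \<open>f z = b\<close> by (auto simp: F_def)
  ultimately have "F facet_of P"
    using face by (simp add: facet_of_def)
  then show ?thesis
    using \<open>linear f\<close> valid by (simp add: facet_defining_def F_def)
qed

subsection \<open>Multicut polytopes and dominants\<close>

lemma component_isolated:
  assumes "u \<in> V" and "\<And>w. {u, w} \<notin> E"
  shows "component V E u = {u}"
proof -
  have "w = u" if "(u, w) \<in> {(a, b). {a, b} \<in> E}\<^sup>*" for w
    using that assms(2) by (auto elim: converse_rtranclE)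
  then show ?thesis
    using assms(1) by (auto simp: component_def)
qed

lemma component_adjacent:
  assumes "{a, b} \<in> E"
  shows "component V E a = component V E b"
proof -
  have "{b, a} \<in> E"
    using assms by (simp add: insert_commute)
  with assms show ?thesis
    by (auto simp: component_def intro: converse_rtrancl_into_rtrancl)
qed

lemma self_in_component: "u \<in> V \<Longrightarrow> u \<in> component V E u"
  by (simp add: component_def)

lemma incidence_vector_nth: "incidence_vector F $ e = (if e \<in> F then 1 else 0)"
  by (simp add: incidence_vector_def)

lemma incidence_vector_eq_sum_axis:
  fixes F :: "'v::finite set set"
  shows "incidence_vector F = (\<Sum>e\<in>F. axis e 1)"
  by (simp add: vec_eq_iff incidence_vector_nth axis_def)

lemma linear_sum_nth: "linear (\<lambda>x::real ^ 'n. \<Sum>e\<in>A. x $ e)"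
  by (simp add: linear_iff sum.distrib sum_distrib_left)

lemma subspace_edge_space: "subspace (edge_space E)"
  by (simp add: subspace_def edge_space_def)

lemma edge_space_subset_span:
  assumes "\<And>e. e \<in> E \<Longrightarrow> axis e 1 \<in> span B"
  shows "edge_space E \<subseteq> span B"
proof
  fix x assume x: "x \<in> edge_space E"
  have "x = (\<Sum>e\<in>E. x $ e *\<^sub>R axis e 1)"
    using x by (auto simp: vec_eq_iff edge_space_def axis_def if_distrib cong: if_cong)
  moreover have "(\<Sum>e\<in>E. x $ e *\<^sub>R axis e 1) \<in> span B"
    by (intro span_sum span_scale assms)
  ultimately show "x \<in> span B"
    by simp
qed

lemma convex_nonneg_orthant: "convex (nonneg_orthant E)"
  by (auto simp: convex_def nonneg_orthant_def edge_space_def)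

lemma convex_multicut_polytope: "convex (multicut_polytope V E S)"
  by (simp add: multicut_polytope_def)

lemma convex_multicut_dominant: "convex (multicut_dominant V E S)"
  by (simp add: multicut_dominant_def convex_set_plus convex_multicut_polytope convex_nonneg_orthant)

lemma incidence_vector_in_multicut_polytope:
  "multicut V E S \<delta> \<Longrightarrow> incidence_vector \<delta> \<in> multicut_polytope V E S"
  by (auto simp: multicut_polytope_def intro: hull_inc)

lemma multicut_polytope_subset_dominant: "multicut_polytope V E S \<subseteq> multicut_dominant V E S"
proof -
  have "0 \<in> nonneg_orthant E"
    by (simp add: nonneg_orthant_def edge_space_def)
  then show ?thesis
    by (force simp: multicut_dominant_def set_plus_def)
qed

lemma multicut_polytope_subset_edge_space: "multicut_polytope V E S \<subseteq> edge_space E"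
  unfolding multicut_polytope_def
  by (rule hull_minimal)
    (auto simp: multicut_def edge_space_def incidence_vector_nth
      intro: subspace_imp_convex[OF subspace_edge_space, unfolded edge_space_def])

lemma multicut_dominant_subset_edge_space: "multicut_dominant V E S \<subseteq> edge_space E"
  using multicut_polytope_subset_edge_space[of V E S] subspace_add[OF subspace_edge_space]
  by (auto simp: multicut_dominant_def nonneg_orthant_def elim!: set_plus_elim)

text \<open>The half-space \<open>f x \<ge> b\<close> is convex, so it contains the hull once it
  contains the generators; the orthant summand can only increase \<open>f\<close>.\<close>

lemma multicut_dominant_ge:
  assumes "linear f" and "\<And>\<delta>. multicut V E S \<delta> \<Longrightarrow> f (incidence_vector \<delta>) \<ge> b"
    and "\<And>x. x \<in> nonneg_orthant E \<Longrightarrow> f x \<ge> 0"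
    and "x \<in> multicut_dominant V E S"
  shows "f x \<ge> (b::real)"
proof -
  have "convex (f -` {b..})"
    by (rule convex_linear_vimage[OF \<open>linear f\<close>]) simp
  then have "multicut_polytope V E S \<subseteq> f -` {b..}"
    unfolding multicut_polytope_def by (intro hull_minimal) (auto simp: assms(2))
  moreover obtain p q where "x = p + q" "p \<in> multicut_polytope V E S" "q \<in> nonneg_orthant E"
    using assms(4) by (auto simp: multicut_dominant_def elim: set_plus_elim)
  ultimately show ?thesis
    using assms(3)[of q] by (auto simp: linear_add[OF \<open>linear f\<close>])
qed

text \<open>The argument runs once for every convex \<open>P\<close> between the polytope and the
  dominant, and is then applied to both ends. The incidence vectors of tight multicuts lie in each
  such \<open>P\<close>, and their span contains the edge space and hence \<open>P\<close>.\<close>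

lemma defines_shared_facetI:
  assumes "linear f" and "\<And>\<delta>. multicut V E S \<delta> \<Longrightarrow> f (incidence_vector \<delta>) \<ge> b"
    and "\<And>x. x \<in> nonneg_orthant E \<Longrightarrow> f x \<ge> 0"
    and "multicut V E S \<delta>\<^sub>0" "f (incidence_vector \<delta>\<^sub>0) = b"
    and "multicut V E S \<delta>\<^sub>1" "f (incidence_vector \<delta>\<^sub>1) \<noteq> b"
    and axis: "\<And>e. e \<in> E \<Longrightarrow>
      axis e 1 \<in> span {incidence_vector \<delta> |\<delta>. multicut V E S \<delta> \<and> f (incidence_vector \<delta>) = b}"
  shows "defines_shared_facet V E S f b"
proof -
  have facet: "facet_defining f b P"
    if P: "convex P" "multicut_polytope V E S \<subseteq> P" "P \<subseteq> multicut_dominant V E S" for P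
  proof (rule facet_definingI[OF \<open>linear f\<close> \<open>convex P\<close>])
    show "f x \<ge> b" if "x \<in> P" for x
      using multicut_dominant_ge[OF assms(1-3)] that P(3) by auto
    show "incidence_vector \<delta>\<^sub>0 \<in> P" "incidence_vector \<delta>\<^sub>1 \<in> P"
      using assms(4,6) P(2) incidence_vector_in_multicut_polytope by blast+
    have "{incidence_vector \<delta> |\<delta>. multicut V E S \<delta> \<and> f (incidence_vector \<delta>) = b}
        \<subseteq> {x \<in> P. f x = b}"
      using P(2) incidence_vector_in_multicut_polytope by fastforce
    then have "edge_space E \<subseteq> span {x \<in> P. f x = b}"
      by (intro edge_space_subset_span subsetD[OF span_mono axis])
    then show "P \<subseteq> span {x \<in> P. f x = b}"
      using P(3) multicut_dominant_subset_edge_space by blast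
  qed (use assms in auto)
  show ?thesis
    unfolding defines_shared_facet_def
    by (intro conjI facet convex_multicut_polytope convex_multicut_dominant
        multicut_polytope_subset_dominant order_refl)
qed

subsection \<open>Cyclic terminal pairs on a star\<close>

lemma sum_shift_mod:
  fixes g :: "nat \<Rightarrow> 'a::comm_monoid_add"
  shows "(\<Sum>i<n. g ((i + 1) mod n)) = (\<Sum>i<n. g i)"
proof (cases n)
  case (Suc k)
  have "(\<Sum>i<Suc k. g ((i + 1) mod Suc k)) = (\<Sum>i<k. g (Suc i)) + g 0"
    by simp
  also have "\<dots> = (\<Sum>i<Suc k. g i)"
    by (subst sum.lessThan_Suc_shift) (simp add: add.commute)
  finally show ?thesis
    by (simp add: Suc)
qed simp

text \<open>Writing the odd \<open>n\<close> as \<open>2 * m + 1\<close> turns the right-hand side,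
  \<open>n / 2\<close> rounded up, into \<open>m + 1\<close>; \<open>m > 0\<close> then says
  \<open>n \<ge> 3\<close>.\<close>

locale cyclic_star =
  fixes n m :: nat and r :: "'v::finite" and v :: "nat \<Rightarrow> 'v"
  assumes n_eq: "n = 2 * m + 1" and m_pos: "m > 0"
    and inj_v: "inj_on v {..<n}" and r_notin: "r \<notin> v ` {..<n}"
begin

abbreviation "V \<equiv> star_vertices n r v"
abbreviation "E \<equiv> star_edges n r v"
abbreviation "S \<equiv> cyclic_terminal_pairs n v"

text \<open>Reducing the index modulo \<open>n\<close> makes every natural number a valid index, so
  cyclic shifts become plain addition.\<close>

definition edge :: "nat \<Rightarrow> 'v set" where
  "edge k = {r, v (k mod n)}"

lemma n_pos [simp]: "0 < n"
  by (simp add: n_eq)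

lemma edge_mod [simp]: "edge (k mod n) = edge k"
  by (simp add: edge_def)

lemma v_eq_iff: "v (i mod n) = v (j mod n) \<longleftrightarrow> i mod n = j mod n"
  using inj_on_eq_iff[OF inj_v] by simp

lemma v_neq_r: "v (i mod n) \<noteq> r"
  using r_notin by (metis image_eqI lessThan_iff mod_less_divisor n_pos)

lemma edge_eq_iff: "edge i = edge j \<longleftrightarrow> i mod n = j mod n"
  by (metis doubleton_eq_iff edge_def v_eq_iff)

lemma E_eq: "E = edge ` {..<n}"
  by (auto simp: star_edges_def edge_def)

lemma edge_in_E: "edge k \<in> E"
  by (metis E_eq edge_mod image_eqI lessThan_iff mod_less_divisor n_pos)

lemma S_eq: "S = {{v (i mod n), v (Suc i mod n)} |i. i < n}"
  unfolding cyclic_terminal_pairs_def by auto (metis mod_less)+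

lemma v_in_V: "v (i mod n) \<in> V"
  by (simp add: star_vertices_def)

lemma sum_E: "(\<Sum>e\<in>E. g e) = (\<Sum>i<n. g (edge i))"
  unfolding E_eq by (subst sum.reindex) (auto intro!: inj_onI simp: edge_eq_iff)

lemma card_E: "card E = n"
  using sum_E[of "\<lambda>_. 1::nat"] by simp

lemma component_leaf:
  assumes "edge i \<in> \<delta>"
  shows "component V (E - \<delta>) (v (i mod n)) = {v (i mod n)}"
proof (rule component_isolated[OF v_in_V])
  fix w
  have "edge j \<in> \<delta>" if "{v (i mod n), w} = edge j" for j
    using that assms v_neq_r[of i] v_eq_iff[of i j] edge_eq_iff[of i j]
    by (auto simp: edge_def doubleton_eq_iff)
  then show "{v (i mod n), w} \<notin> E - \<delta>"
    by (auto simp: E_eq)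
qed

text \<open>If both edges survive, the two leaves are joined through \<open>r\<close>; if one is
  deleted, its leaf is isolated.\<close>

lemma multicut_iff:
  "multicut V E S \<delta> \<longleftrightarrow> \<delta> \<subseteq> E \<and> (\<forall>i<n. edge i \<in> \<delta> \<or> edge (Suc i) \<in> \<delta>)"
proof -
  have leaves: "component V (E - \<delta>) (v (i mod n)) \<noteq> component V (E - \<delta>) (v (Suc i mod n))
      \<longleftrightarrow> edge i \<in> \<delta> \<or> edge (Suc i) \<in> \<delta>" for i
  proof
    assume neq: "component V (E - \<delta>) (v (i mod n)) \<noteq> component V (E - \<delta>) (v (Suc i mod n))"
    have "component V (E - \<delta>) (v (k mod n)) = component V (E - \<delta>) r" if "edge k \<notin> \<delta>" for k
      using that edge_in_E[of k] by (intro component_adjacent) (simp add: edge_def insert_commute)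
    with neq show "edge i \<in> \<delta> \<or> edge (Suc i) \<in> \<delta>"
      by metis
  next
    \<comment> \<open>Since \<open>n > 1\<close>, the two leaves differ, so the singleton component
      of the isolated one misses the other.\<close>
    have "i mod n \<noteq> Suc i mod n"
      using m_pos by (auto simp: mod_Suc n_eq)
    then have "v (i mod n) \<noteq> v (Suc i mod n)"
      by (simp add: v_eq_iff)
    moreover assume "edge i \<in> \<delta> \<or> edge (Suc i) \<in> \<delta>"
    ultimately show
      "component V (E - \<delta>) (v (i mod n)) \<noteq> component V (E - \<delta>) (v (Suc i mod n))"
      using component_leaf self_in_component[OF v_in_V] by (metis singletonD)
  qed
  show ?thesis
    unfolding multicut_def S_eq leaves[symmetric] by (fastforce simp: doubleton_eq_iff)
qed

lemma sum_incidence_multicut_ge: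
  assumes "multicut V E S \<delta>"
  shows "(\<Sum>e\<in>E. incidence_vector \<delta> $ e) \<ge> real m + 1"
proof -
  define g :: "nat \<Rightarrow> nat" where "g i = of_bool (edge i \<in> \<delta>)" for i
  have "n = (\<Sum>i<n. 1)"
    by simp
  also have "\<dots> \<le> (\<Sum>i<n. g i + g ((i + 1) mod n))"
    using assms by (intro sum_mono) (auto simp: multicut_iff g_def)
  also have "\<dots> = 2 * (\<Sum>i<n. g i)"
    by (simp only: sum.distrib sum_shift_mod mult_2)
  \<comment> \<open>Rounding up happens here: over the naturals,
    \<open>2 * m + 1 \<le> 2 * s\<close> forces \<open>m + 1 \<le> s\<close>.\<close>
  finally have "m + 1 \<le> (\<Sum>i<n. g i)"
    by (simp add: n_eq)
  then have "real (m + 1) \<le> real (\<Sum>i<n. g i)"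
    by (rule of_nat_mono)
  also have "\<dots> = (\<Sum>e\<in>E. incidence_vector \<delta> $ e)"
    by (simp add: sum_E incidence_vector_nth g_def of_bool_def if_distrib cong: if_cong
        del: sum_of_bool_eq)
  finally show ?thesis
    by simp
qed

text \<open>Every second edge is taken, starting at \<open>k\<close>. Because \<open>n\<close> is
  odd, the last one, \<open>k + 2 * m\<close>, is the cyclic predecessor of \<open>k\<close>, so one
  pair of consecutive edges is taken in full.\<close>

definition alternating :: "nat \<Rightarrow> 'v set set" where
  "alternating k = (\<lambda>j. edge (k + 2 * j)) ` {..m}"

lemma multicut_alternating: "multicut V E S (alternating k)"
proof -
  have in_alternating: "edge (k + t) \<in> alternating k" if "even t" "t < n" for t
  proof -
    obtain j where "t = 2 * j"
      using \<open>even t\<close> by (rule evenE)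
    then show ?thesis
      using \<open>t < n\<close> unfolding alternating_def by (intro image_eqI[of _ _ j]) (simp_all add: n_eq)
  qed
  have "edge i \<in> alternating k \<or> edge (Suc i) \<in> alternating k" if "i < n" for i
  proof -
    \<comment> \<open>\<open>t\<close> is the offset of \<open>i\<close> from \<open>k\<close>
      modulo \<open>n\<close>. The multiple \<open>n * k\<close> keeps the natural subtraction from
      truncating.\<close>
    define t where "t = (i + n * k - k) mod n"
    have "k \<le> n * k"
      by (cases n) (use n_pos in auto)
    then have "k + (i + n * k - k) = i + n * k"
      by linarith
    then have t: "(k + t) mod n = i mod n"
      unfolding t_def mod_add_right_eq by simp
    have "t < n"
      by (simp add: t_def)
    show ?thesis
    proof (cases "even t")
      case True
      then show ?thesis
        using in_alternating[OF True \<open>t < n\<close>] t by (metis edge_eq_iff)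
    next
      case False
      \<comment> \<open>An odd offset cannot be the largest one, \<open>2 * m\<close>, so the next
        offset is even and still in range.\<close>
      then have "Suc t < n"
        using \<open>t < n\<close> n_eq by presburger
      moreover have "Suc i mod n = (k + Suc t) mod n"
        using t by (metis add_Suc_right mod_Suc_eq)
      ultimately show ?thesis
        using in_alternating[of "Suc t"] False by (metis edge_eq_iff even_Suc)
    qed
  qed
  then show ?thesis
    using edge_in_E by (auto simp: multicut_iff alternating_def)
qed

text \<open>The offsets \<open>2 * j\<close> stay below \<open>n\<close>, so the listed edges are
  distinct and no unit vector occurs twice.\<close>

lemma incidence_alternating:
  "incidence_vector (alternating k) = (\<Sum>j\<le>m. axis (edge (k + 2 * j)) 1)"
proof -
  have "inj_on (\<lambda>j. edge (k + 2 * j)) {..m}"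
  proof (rule inj_onI)
    fix i j assume "i \<in> {..m}" "j \<in> {..m}" "edge (k + 2 * i) = edge (k + 2 * j)"
    then have "(2 * i) mod n = (2 * j) mod n"
      by (simp add: edge_eq_iff nat_mod_eq_iff)
    then show "i = j"
      using \<open>i \<in> {..m}\<close> \<open>j \<in> {..m}\<close> by (simp add: n_eq)
  qed
  then show ?thesis
    unfolding incidence_vector_eq_sum_axis alternating_def by (subst sum.reindex) simp_all
qed

lemma sum_incidence_alternating: "(\<Sum>e\<in>E. incidence_vector (alternating k) $ e) = real m + 1"
proof -
  have "(\<Sum>e\<in>E. incidence_vector (alternating k) $ e)
      = (\<Sum>j\<le>m. \<Sum>e\<in>E. axis (edge (k + 2 * j)) 1 $ e)"
    unfolding incidence_alternating sum_component by (rule sum.swap)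
  also have "\<dots> = (\<Sum>j\<le>m. 1)"
    using edge_in_E by (simp add: axis_def)
  finally show ?thesis
    by simp
qed

lemma axis_edge_in_span:
  "axis (edge k) 1 \<in> span (range (\<lambda>k. incidence_vector (alternating k)))" (is "_ \<in> ?W")
proof -
  have alternating: "(\<Sum>j\<le>m. axis (edge (k + 2 * j)) 1) \<in> ?W" for k
    by (metis incidence_alternating rangeI span_base)
  have step: "axis (edge (Suc k)) 1 - axis (edge k) 1 \<in> ?W" for k
  proof -
    let ?a = "\<lambda>j. axis (edge (k + 2 * j)) (1::real)"
    have "k + 2 * Suc m = Suc k + n"
      by (simp add: n_eq)
    then have "edge (k + 2 * Suc m) = edge (Suc k)"
      by (simp only: edge_eq_iff mod_add_self2)
    then have "axis (edge (Suc k)) 1 - axis (edge k) 1 = (\<Sum>j\<le>m. ?a (Suc j) - ?a j)"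
      using sum_lessThan_telescope[of ?a "Suc m"] by (simp only: lessThan_Suc_atMost) simp
    also have "\<dots> = (\<Sum>j\<le>m. axis (edge (k + 2 + 2 * j)) 1) - (\<Sum>j\<le>m. ?a j)"
      by (simp add: sum_subtractf)
    finally show ?thesis
      using alternating by (metis span_diff)
  qed
  have diff: "axis (edge k) 1 - axis (edge 0) 1 \<in> ?W" for k
  proof (induction k)
    case (Suc k)
    show ?case
      using span_add[OF step[of k] Suc] by simp
  qed (simp add: span_zero)
  \<comment> \<open>Exchanging each edge of \<open>alternating 0\<close> for \<open>edge 0\<close>,
    by differences already in the span, leaves \<open>m + 1\<close> copies of a single unit
    vector.\<close>
  have "(\<Sum>j\<le>m. axis (edge (0 + 2 * j)) 1)
      - (\<Sum>j\<le>m. axis (edge (2 * j)) 1 - axis (edge 0) 1) \<in> ?W"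
    by (intro span_diff[OF alternating] span_sum diff)
  then have "real (m + 1) *\<^sub>R axis (edge 0) 1 \<in> ?W"
    by (simp add: sum_subtractf sum_constant_scaleR del: sum_constant)
  from span_scale[OF this, of "inverse (real (m + 1))"] have "axis (edge 0) 1 \<in> ?W"
    by simp
  then show ?thesis
    using span_add[OF diff] by (metis diff_add_cancel)
qed

lemma defines_shared_facet_star: "defines_shared_facet V E S (\<lambda>x. \<Sum>e\<in>E. x $ e) (real m + 1)"
proof (rule defines_shared_facetI[OF linear_sum_nth sum_incidence_multicut_ge])
  show "(\<Sum>e\<in>E. x $ e) \<ge> 0" if "x \<in> nonneg_orthant E" for x
    using that by (intro sum_nonneg) (simp add: nonneg_orthant_def)
  show "multicut V E S (alternating 0)" "(\<Sum>e\<in>E. incidence_vector (alternating 0) $ e) = real m + 1"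
    by (simp_all add: multicut_alternating sum_incidence_alternating)
  \<comment> \<open>The full edge set witnesses properness of the face: it has
    \<open>2 * m + 1\<close> edges, more than \<open>m + 1\<close> because
    \<open>m > 0\<close>.\<close>
  show "multicut V E S E"
    using edge_in_E by (auto simp: multicut_iff)
  show "(\<Sum>e\<in>E. incidence_vector E $ e) \<noteq> real m + 1"
    using m_pos card_E n_eq by (simp add: incidence_vector_nth)
  have "range (\<lambda>k. incidence_vector (alternating k)) \<subseteq>
      {incidence_vector \<delta> |\<delta>. multicut V E S \<delta> \<and> (\<Sum>e\<in>E. incidence_vector \<delta> $ e) = real m + 1}"
    using multicut_alternating sum_incidence_alternating by blast
  then show "axis e 1 \<in> span
      {incidence_vector \<delta> |\<delta>. multicut V E S \<delta> \<and> (\<Sum>e\<in>E. incidence_vector \<delta> $ e) = real m + 1}"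
    if "e \<in> E" for e
    using that axis_edge_in_span span_mono unfolding E_eq by blast
qed

end

theorem theorem5p1:
  fixes n :: nat and r :: "'v::finite" and v :: "nat \<Rightarrow> 'v"
  assumes "n \<ge> 3" and "odd n"
    and "inj_on v {..<n}" and "r \<notin> v ` {..<n}"
  shows "defines_shared_facet (star_vertices n r v) (star_edges n r v) (cyclic_terminal_pairs n v)
           (\<lambda>x. \<Sum>e\<in>star_edges n r v. x $ e) (of_int \<lceil>real n / 2\<rceil>)"
proof -
  obtain m where m: "n = 2 * m + 1"
    using \<open>odd n\<close> by (rule oddE)
  interpret cyclic_star n m r v
    using assms m by unfold_locales auto
  have "\<lceil>real n / 2\<rceil> = int m + 1"
    by (rule ceiling_unique) (simp_all add: m)
  then show ?thesis
    using defines_shared_facet_star by simp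
qed

end
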